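(* For every degree $m\ge 2$, the discrete quasi-interpolants $Q_2^*$ of degree $m$ are bounded uniformly with respect to the partition. More specifically, for all partitions $T$ of $I$ (with $I=\mathbb{R}$ or $I=[a,b]$), $$\Vert Q_2^*\Vert_\infty\le\left\lfloor \tfrac12(m+4)\right\rfloor .$$
   Context: Partitions. Either $I=\mathbb{R}$, with a strictly increasing knot sequence $T=\{t_i\}_{i\in\mathbb{Z}}$ such that $|t_i|\to+\infty$ as $|i|\to+\infty$, and $J=\mathbb{Z}$; or $I=[a,b]$ is a bounded interval with knots $t_{-m}=\cdots=t_0=a<t_1<\cdots<t_{n-1}<b=t_n=\cdots=t_{n+m}$, and $J=\{0,\ldots,n+m-1\}$. B-splines. For $j\in J$, $B_j$ is the B-spline of degree $m$ with knots $t_{j-m},\ldots,t_{j+1}$ (support $[t_{j-m},t_{j+1}]$), normalized so that $\sum_{j\in J}B_j=1$ on $I$. Knot averages. For $j\in J$, put $T_j=\{t_{j-m+1},\ldots,t_j\}$ and $$\theta_j=\frac1m\sum_{r=1}^m t_{j+1-r},\qquad \theta_j^{(2)}=\frac{2}{m(m-1)}\sum_{1\le r<s\le m}t_{j+1-r}t_{j+1-s},\qquad \bar\theta_j^{(2)}=\theta_j^2-\theta_j^{(2)}.$$ The operator. $Q_2^*f=\sum_{j\in J}\lambda_j^*(f)B_j$ with $$\lambda_j^*(f)=f(\theta_j)-\bar\theta_j^{(2)}\,[\theta_{j-1},\theta_j,\theta_{j+1}]f,$$ where $[\cdot,\cdot,\cdot]f$ is the second order divided difference. When $I=[a,b]$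 and $j=0$ or $j=n+m-1$, one has $\bar\theta_j^{(2)}=0$, and $\lambda_j^*(f)=f(\theta_j)$. $\Vert Q\Vert_\infty$ is the operator norm: the supremum of $\Vert Qf\Vert_\infty$ over bounded continuous $f:I\to\mathbb{R}$ with $\Vert f\Vert_\infty\le1$, where $\Vert\cdot\Vert_\infty$ is the sup norm on $I$. *)

theory Defs
  imports "HOL-Analysis.Analysis"
begin

text \<open>
  Knot sequences are functions on the integers.  In the interval case only the values at
  \<open>-m, \<dots>, n + m\<close> are constrained, and only these are ever used.
\<close>

definition line_knots :: "(int \<Rightarrow> real) \<Rightarrow> bool" where
  "line_knots t \<longleftrightarrow> strict_mono t \<and>
     filterlim (\<lambda>i. \<bar>t i\<bar>) at_top (filtercomap (\<lambda>i. \<bar>i\<bar>) at_top)"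

definition interval_knots :: "nat \<Rightarrow> nat \<Rightarrow> real \<Rightarrow> real \<Rightarrow> (int \<Rightarrow> real) \<Rightarrow> bool" where
  "interval_knots m n a b t \<longleftrightarrow>
     (\<forall>i\<in>{- int m..0}. t i = a) \<and>
     strict_mono_on {0..int n} t \<and>
     (\<forall>i\<in>{int n..int n + int m}. t i = b)"

inductive spline_partition :: "nat \<Rightarrow> real set \<Rightarrow> int set \<Rightarrow> (int \<Rightarrow> real) \<Rightarrow> bool"
  for m :: nat where
  line: "line_knots t \<Longrightarrow> spline_partition m UNIV UNIV t"
| interval: "a < b \<Longrightarrow> 1 \<le> n \<Longrightarrow> interval_knots m n a b t \<Longrightarrow>
     spline_partition m {a..b} {0..int n + int m - 1} t"

text \<open>
  Cox--de Boor recursion, indexed such that \<open>bspline I t k j\<close> is the B-spline of degree \<open>k\<close> with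
  knots \<open>t (j - k), \<dots>, t (j + 1)\<close>.  Terms with a vanishing denominator are zero.  Degree-zero
  B-splines are right-continuous, except that at the right end point of \<open>I\<close> (if there is one)
  they take their left limits.  This recursion produces the B-splines
  normalized to sum up to one on \<open>I\<close>; see \<open>bspline_sum_eq_1\<close> below.
\<close>

primrec bspline :: "real set \<Rightarrow> (int \<Rightarrow> real) \<Rightarrow> nat \<Rightarrow> int \<Rightarrow> real \<Rightarrow> real" where
  "bspline I t 0 j x =
     (if t j \<le> x \<and> x < t (j + 1) \<or> t j < x \<and> x = t (j + 1) \<and> (\<forall>y\<in>I. y \<le> x) then 1 else 0)"
| "bspline I t (Suc k) j x =
     (x - t (j - int k - 1)) / (t j - t (j - int k - 1)) * bspline I t k (j - 1) x +
     (t (j + 1) - x) / (t (j + 1) - t (j - int k)) * bspline I t k j x"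

definition knot_avg :: "nat \<Rightarrow> (int \<Rightarrow> real) \<Rightarrow> int \<Rightarrow> real" where
  "knot_avg m t j = 1 / real m * (\<Sum>r=1..m. t (j + 1 - int r))"

definition knot_avg2 :: "nat \<Rightarrow> (int \<Rightarrow> real) \<Rightarrow> int \<Rightarrow> real" where
  "knot_avg2 m t j = 2 / (real m * (real m - 1)) *
     (\<Sum>(r, s) \<in> {(r, s). 1 \<le> r \<and> r < s \<and> s \<le> m}. t (j + 1 - int r) * t (j + 1 - int s))"

definition knot_var :: "nat \<Rightarrow> (int \<Rightarrow> real) \<Rightarrow> int \<Rightarrow> real" where
  "knot_var m t j = (knot_avg m t j)\<^sup>2 - knot_avg2 m t j"

definition divdiff2 :: "real \<Rightarrow> real \<Rightarrow> real \<Rightarrow> (real \<Rightarrow> real) \<Rightarrow> real" where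
  "divdiff2 x y z f = ((f z - f y) / (z - y) - (f y - f x) / (y - x)) / (z - x)"

text \<open>
  For the first and the last index on a bounded interval, two of the three points of the divided
  difference coincide, but then \<open>knot_var\<close> is zero and the functional is evaluation at the knot
  average; see \<open>qi_functional_boundary\<close> below.
\<close>

definition qi_functional :: "nat \<Rightarrow> (int \<Rightarrow> real) \<Rightarrow> int \<Rightarrow> (real \<Rightarrow> real) \<Rightarrow> real" where
  "qi_functional m t j f = f (knot_avg m t j) -
     knot_var m t j * divdiff2 (knot_avg m t (j - 1)) (knot_avg m t j) (knot_avg m t (j + 1)) f"

text \<open>At each point only finitely many terms of the sum are nonzero.\<close>

definition quasi_interpolant ::
    "nat \<Rightarrow> real set \<Rightarrow> int set \<Rightarrow> (int \<Rightarrow> real) \<Rightarrow> (real \<Rightarrow> real) \<Rightarrow> real \<Rightarrow> real" where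
  "quasi_interpolant m I J t f x = (\<Sum>\<^sub>\<infinity>j\<in>J. qi_functional m t j f * bspline I t m j x)"

definition sup_norm_on :: "real set \<Rightarrow> (real \<Rightarrow> real) \<Rightarrow> ereal" where
  "sup_norm_on I f = (SUP x\<in>I. ereal \<bar>f x\<bar>)"

definition op_norm_on :: "real set \<Rightarrow> ((real \<Rightarrow> real) \<Rightarrow> real \<Rightarrow> real) \<Rightarrow> ereal" where
  "op_norm_on I Q =
     (SUP f\<in>{f. continuous_on I f \<and> bounded (f ` I) \<and> sup_norm_on I f \<le> 1}. sup_norm_on I (Q f))"

lemma bspline_nonzeroD:
  assumes "bspline I t k j x \<noteq> 0" "mono_on {j - int k..j + 1} t"
  shows "t (j - int k) \<le> x \<and> t (j - int k) < t (j + 1) \<and>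
    (x < t (j + 1) \<or> x = t (j + 1) \<and> (\<forall>y\<in>I. y \<le> x))"
  using assms
proof (induction k arbitrary: j)
  case 0
  then show ?case by (auto split: if_splits)
next
  case (Suc k)
  have m: "t u \<le> t v" if "j - int k - 1 \<le> u" "u \<le> v" "v \<le> j + 1" for u v
    using that Suc.prems(2) by (auto simp: mono_on_def)
  have m1: "mono_on {j - int k..j + 1} t" and m2: "mono_on {j - 1 - int k..j - 1 + 1} t"
    using m by (auto simp: mono_on_def)
  have "bspline I t k (j - 1) x \<noteq> 0 \<or> bspline I t k j x \<noteq> 0"
    using Suc.prems(1) by auto
  then show ?case
  proof
    assume "bspline I t k (j - 1) x \<noteq> 0"
    from Suc.IH[OF this m2] m[of j "j + 1"] show ?thesis
      by (auto simp: algebra_simps)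
  next
    assume "bspline I t k j x \<noteq> 0"
    from Suc.IH[OF this m1] m[of "j - int k - 1" "j - int k"] show ?thesis
      by (auto simp: algebra_simps)
  qed
qed

lemma bspline_sum_aux:
  assumes "p \<le> q" "mono_on {p..q} t" "\<And>i. i \<in> {p..q} \<Longrightarrow> t i \<in> I" "x \<in> I"
    and "t (p + int k) \<le> x" "x < t (q - int k) \<or> t (p + int k) < x \<and> x = t (q - int k) \<and> (\<forall>y\<in>I. y \<le> x)"
    and "p + int k \<le> q - int k"
  shows "(\<Sum>j\<in>{p + int k..q - 1}. bspline I t k j x) = 1"
  using assms(5-)
proof (induction k)
  case 0
  define H :: "int \<Rightarrow> real" where "H = (\<lambda>j. of_bool (x < t j \<or> x = t j \<and> (\<forall>y\<in>I. y \<le> x)))"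
  have m: "t u \<le> t v" if "p \<le> u" "u \<le> v" "v \<le> q" for u v
    using that assms(2) by (auto simp: mono_on_def)
  have B: "bspline I t 0 j x = H (j + 1) - H j" if "p \<le> j" "j < q" for j
    using m[of j "j + 1"] that assms(3)[of j] assms(3)[of "j + 1"] assms(4)
    by (auto simp: H_def)
  have tele: "(\<Sum>j\<in>{p..r - 1}. H (j + 1) - H j) = H r - H p" if "p \<le> r" for r
    using that
  proof (induction r rule: int_ge_induct)
    case (step r)
    have "{p..r + 1 - 1} = insert r {p..r - 1}" using step.hyps by auto
    then show ?case using step by simp
  qed simp
  have "(\<Sum>j\<in>{p..q - 1}. bspline I t 0 j x) = (\<Sum>j\<in>{p..q - 1}. H (j + 1) - H j)"
    by (intro sum.cong) (auto simp: B simp del: bspline.simps)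
  also have "\<dots> = H q - H p" using tele assms(1) by simp
  also have "\<dots> = 1"
    using 0 assms(3)[of q] assms(1) by (force simp: H_def)
  finally show ?case by simp
next
  case (Suc k)
  let ?u = "p + int k" and ?v = "q - 1"
  let ?B = "\<lambda>j. bspline I t k j x"
  let ?L = "\<lambda>j. (x - t (j - int k)) / (t (j + 1) - t (j - int k))"
  let ?R = "\<lambda>j. (t (j + 1) - x) / (t (j + 1) - t (j - int k))"
  have m: "t u \<le> t v" if "p \<le> u" "u \<le> v" "v \<le> q" for u v
    using that assms(2) by (auto simp: mono_on_def)
  have D: "t (j - int k) \<le> x \<and> t (j - int k) < t (j + 1) \<and> x \<le> t (j + 1)"
    if "?B j \<noteq> 0" "?u \<le> j" "j \<le> ?v" for j
  proof -
    have "mono_on {j - int k..j + 1} t" using that m by (auto simp: mono_on_def)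
    from bspline_nonzeroD[OF that(1) this] show ?thesis by auto
  qed
  have IH: "(\<Sum>j\<in>{?u..?v}. ?B j) = 1"
  proof (rule Suc.IH)
    show "t ?u \<le> x" using Suc.prems m[of ?u "?u + 1"] by (simp add: algebra_simps)
    show "x < t (q - int k) \<or> t (p + int k) < x \<and> x = t (q - int k) \<and> (\<forall>y\<in>I. y \<le> x)"
      using Suc.prems m[of ?u "?u + 1"] m[of "q - int k - 1" "q - int k"]
      by (auto simp: algebra_simps)
  qed (use Suc.prems in auto)
  have uv: "?u < ?v" using Suc.prems by simp
  have "(\<Sum>j\<in>{p + int (Suc k)..?v}. bspline I t (Suc k) j x)
      = (\<Sum>j\<in>{?u + 1..?v}. ?L (j - 1) * ?B (j - 1)) + (\<Sum>j\<in>{?u + 1..?v}. ?R j * ?B j)"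
    by (simp add: sum.distrib[symmetric] algebra_simps)
  also have "(\<Sum>j\<in>{?u + 1..?v}. ?L (j - 1) * ?B (j - 1)) = (\<Sum>j\<in>{?u..?v - 1}. ?L j * ?B j)"
    by (rule sum.reindex_bij_witness[of _ "\<lambda>j. j + 1" "\<lambda>j. j - 1"]) auto
  also have "\<dots> = (\<Sum>j\<in>{?u..?v}. ?L j * ?B j)"
  proof -
    have "?L ?v * ?B ?v = 0"
    proof (cases "?B ?v = 0")
      case False
      from D[OF this] uv Suc.prems show ?thesis by (auto simp: algebra_simps)
    qed simp
    moreover have "{?u..?v} = insert ?v {?u..?v - 1}" using uv by auto
    ultimately show ?thesis by simp
  qed
  also have "(\<Sum>j\<in>{?u + 1..?v}. ?R j * ?B j) = (\<Sum>j\<in>{?u..?v}. ?R j * ?B j)"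
  proof -
    have "?R ?u * ?B ?u = 0"
    proof (cases "?B ?u = 0")
      case False
      from D[OF this] uv Suc.prems show ?thesis by (auto simp: algebra_simps)
    qed simp
    moreover have "{?u..?v} = insert ?u {?u + 1..?v}" using uv by auto
    ultimately show ?thesis by simp
  qed
  also have "(\<Sum>j\<in>{?u..?v}. ?L j * ?B j) + (\<Sum>j\<in>{?u..?v}. ?R j * ?B j) = (\<Sum>j\<in>{?u..?v}. ?B j)"
    unfolding sum.distrib[symmetric]
  proof (rule sum.cong)
    fix j assume "j \<in> {?u..?v}"
    show "?L j * ?B j + ?R j * ?B j = ?B j"
    proof (cases "?B j = 0")
      case False
      from D[OF this] \<open>j \<in> _\<close> have "t (j - int k) < t (j + 1)" by auto
      then have "?L j + ?R j = 1" by (simp add: add_divide_distrib[symmetric])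
      then show ?thesis by (metis distrib_right mult_1)
    qed simp
  qed simp
  finally show ?case using IH by simp
qed

lemma interval_knots_mono:
  assumes "a < b" "1 \<le> n" "interval_knots m n a b t"
  shows "mono_on {- int m..int n + int m} t" "\<And>i. i \<in> {- int m..int n + int m} \<Longrightarrow> t i \<in> {a..b}"
proof -
  have 1: "t i = a" if "- int m \<le> i" "i \<le> 0" for i
    using assms(3) that by (auto simp: interval_knots_def)
  have 2: "t i = b" if "int n \<le> i" "i \<le> int n + int m" for i
    using assms(3) that by (auto simp: interval_knots_def)
  have 3: "t i < t j" if "0 \<le> i" "i < j" "j \<le> int n" for i j
    using assms(3) that by (auto simp: interval_knots_def strict_mono_on_def)
  have 4: "t i \<in> {a..b}" if "- int m \<le> i" "i \<le> int n + int m" for i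
    using 1[of i] 2[of i] 1[of 0] 2[of "int n"] 3[of 0 i] 3[of i "int n"] that assms(1)
    by (cases "i \<le> 0"; cases "i \<ge> int n") auto
  then show "\<And>i. i \<in> {- int m..int n + int m} \<Longrightarrow> t i \<in> {a..b}" by auto
  show "mono_on {- int m..int n + int m} t"
  proof (rule mono_onI)
    fix i j assume ij: "i \<in> {- int m..int n + int m}" "j \<in> {- int m..int n + int m}" "i \<le> j"
    then show "t i \<le> t j"
      using 1[of i] 2[of j] 4[of i] 4[of j] 3[of i j]
      by (cases "i \<le> 0"; cases "j \<ge> int n"; cases "i = j") auto
  qed
qed

lemma bspline_sum_eq_1:
  assumes "spline_partition m I J t" "x \<in> I"
  shows "(\<Sum>\<^sub>\<infinity>j\<in>J. bspline I t m j x) = 1"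
  using assms
proof cases
  case (interval a b n)
  note mo = interval_knots_mono[OF interval(3-5)]
  have ab: "t 0 = a" "t (int n) = b" using interval(5) by (auto simp: interval_knots_def)
  have "(\<Sum>j\<in>{- int m + int m..(int n + int m) - 1}. bspline I t m j x) = 1"
    by (rule bspline_sum_aux) (use interval mo ab assms(2) in auto)
  then show ?thesis using interval by simp
next
  case line
  have sm: "t u < t v" if "u < v" for u v
    using line that by (auto simp: line_knots_def strict_mono_def)
  have lim: "filterlim (\<lambda>i. \<bar>t i\<bar>) at_top (filtercomap (\<lambda>i. \<bar>i\<bar>) at_top)"
    using line by (simp add: line_knots_def)
  then have "eventually (\<lambda>i. \<bar>t i\<bar> > max \<bar>x\<bar> \<bar>t 0\<bar>) (filtercomap (\<lambda>i. \<bar>i\<bar>) at_top)"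
    unfolding filterlim_at_top_dense by blast
  then obtain N where N: "\<And>i. N \<le> \<bar>i\<bar> \<Longrightarrow> \<bar>t i\<bar> > max \<bar>x\<bar> \<bar>t 0\<bar>"
    by (auto simp: eventually_filtercomap eventually_at_top_linorder)
  define M where "M = max 1 N"
  have M: "0 < M" "N \<le> M" by (auto simp: M_def)
  have 1: "t (- M) < x" using N[of "- M"] sm[of "- M" 0] M by linarith
  have 2: "x < t M" using N[of M] sm[of 0 M] M by linarith
  let ?p = "- M - int m" and ?q = "M + int m"
  have mo: "mono_on A t" for A using sm by (auto simp: mono_on_def le_less)
  have "(\<Sum>j\<in>{?p + int m..?q - 1}. bspline I t m j x) = 1"
    by (rule bspline_sum_aux) (use line 1 2 mo M in auto)
  moreover have "bspline I t m j x = 0" if "j \<notin> {?p + int m..?q - 1}" for j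
  proof (rule ccontr)
    assume "bspline I t m j x \<noteq> 0"
    from bspline_nonzeroD[OF this mo] line(1)
    have *: "t (j - int m) \<le> x" "x \<le> t (j + 1)" by auto
    then have "\<not> M \<le> j - int m" "\<not> j + 1 \<le> - M"
      using 1 2 sm by (smt (verit))+
    with that show False by auto
  qed
  then have "(\<Sum>\<^sub>\<infinity>j\<in>J. bspline I t m j x) = (\<Sum>\<^sub>\<infinity>j\<in>{?p + int m..?q - 1}. bspline I t m j x)"
    using line by (intro infsum_cong_neutral) auto
  ultimately show ?thesis by simp
qed

lemma knot_var_eq_0:
  assumes "2 \<le> m" "\<And>r. 1 \<le> r \<Longrightarrow> r \<le> m \<Longrightarrow> t (j + 1 - int r) = c"
  shows "knot_var m t j = 0"
proof -
  let ?P = "{(r, s). 1 \<le> r \<and> r < s \<and> s \<le> m}"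
  have "?P = (SIGMA s:{1..m}. {1..<s})\<inverse>" by auto
  then have "card ?P = card (SIGMA s:{1..m}. {1..<s})" by (simp only: card_inverse)
  also have "\<dots> = (\<Sum>s=1..m. s - 1)" by simp
  also have "real \<dots> = (\<Sum>s=1..m. real s - 1)" by (simp add: of_nat_diff)
  also have "\<dots> = real m * (real m - 1) / 2" by (induction m) (auto simp: field_simps)
  finally have card: "real (card ?P) = real m * (real m - 1) / 2" .
  have "(\<Sum>(r, s)\<in>?P. t (j + 1 - int r) * t (j + 1 - int s)) = (\<Sum>_\<in>?P. c * c)"
    by (intro sum.cong) (auto simp: assms(2))
  also have "\<dots> = real m * (real m - 1) / 2 * c\<^sup>2"
    by (simp only: sum_constant card power2_eq_square)
  finally have "knot_avg2 m t j = 2 / (real m * (real m - 1)) * (real m * (real m - 1) / 2 * c\<^sup>2)"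
    by (simp only: knot_avg2_def)
  then have "knot_avg2 m t j = c\<^sup>2"
    using assms(1) by simp
  moreover have "knot_avg m t j = c"
    using assms by (simp add: knot_avg_def)
  ultimately show ?thesis by (simp add: knot_var_def)
qed

lemma qi_functional_boundary:
  assumes "2 \<le> m" "interval_knots m n a b t" "j = 0 \<or> j = int n + int m - 1"
  shows "knot_var m t j = 0" "qi_functional m t j f = f (knot_avg m t j)"
proof -
  from assms(3) show "knot_var m t j = 0"
  proof
    assume "j = 0"
    then show ?thesis
      using assms(2) by (intro knot_var_eq_0[OF assms(1), where c = a]) (auto simp: interval_knots_def)
  next
    assume "j = int n + int m - 1"
    then show ?thesis
      using assms(2) by (intro knot_var_eq_0[OF assms(1), where c = b]) (auto simp: interval_knots_def)
  qed
  then show "qi_functional m t j f = f (knot_avg m t j)"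
    by (simp add: qi_functional_def)
qed

end

theory Submission
  imports Defs
begin

text \<open>
  The B-splines are nonnegative and sum up to one on \<open>I\<close>, so the operator norm is at most the
  supremum over \<open>j\<close> of the norms of the functionals \<open>\<lambda>\<^sub>j\<close>.  Write \<open>h' = \<theta>\<^sub>j - \<theta>\<^sub>j\<^sub>-\<^sub>1\<close>,
  \<open>h = \<theta>\<^sub>j\<^sub>+\<^sub>1 - \<theta>\<^sub>j\<close>, and let \<open>v \<ge> 0\<close> be \<open>knot_var m t j\<close>.  Expanding the divided difference
  bounds the norm of \<open>\<lambda>\<^sub>j\<close> by \<open>1 + 2 v / (h h')\<close> (\<open>divdiff2_functional_bound\<close>), so it remains to
  bound \<open>v / (h h')\<close> independently of the knots.

  Let \<open>L\<close> be the distance between the extreme knots \<open>t\<^sub>j\<^sub>-\<^sub>m\<^sub>+\<^sub>1\<close> and \<open>t\<^sub>j\<close> averaged in \<open>\<theta>\<^sub>j\<close>.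
  Since \<open>m h = t\<^sub>j\<^sub>+\<^sub>1 - t\<^sub>j\<^sub>-\<^sub>m\<^sub>+\<^sub>1\<close> and \<open>m h' = t\<^sub>j - t\<^sub>j\<^sub>-\<^sub>m\<close>, both \<open>m h\<close> and \<open>m h'\<close> are at least
  \<open>L\<close>.  On the other hand,
  \<open>m\<^sup>2 (m - 1) v = m \<Sum>x\<^sub>r\<^sup>2 - (\<Sum>x\<^sub>r)\<^sup>2\<close>, where the \<open>x\<^sub>r\<close> are these \<open>m\<close> knots (\<open>knot_var_eq\<close>), and the
  right-hand side is at most \<open>\<lfloor>m\<^sup>2 / 4\<rfloor> L\<^sup>2\<close>: a sample in an interval has largest variance if it is
  split as evenly as possible between the two end points (\<open>sample_variance_bound\<close>).  Hence
  \<open>v / (h h') \<le> \<lfloor>m\<^sup>2 / 4\<rfloor> / (m - 1)\<close>, and \<open>1 + 2 \<lfloor>m\<^sup>2 / 4\<rfloor> / (m - 1) \<le> \<lfloor>(m + 4) / 2\<rfloor>\<close>.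
  If \<open>L = 0\<close>, then \<open>v = 0\<close> and \<open>\<lambda>\<^sub>j\<close> is the evaluation at \<open>\<theta>\<^sub>j\<close>.
\<close>

section \<open>Sharp variance bound for finite samples\<close>

text \<open>
  For an even number of signs the sum can vanish; for an odd number it is at least one in absolute
  value.  The following lemma is the version of the latter for numbers in \<open>[-1, 1]\<close>, with a penalty
  for those that are not signs.
\<close>

lemma odd_card_sum_squares:
  fixes w :: "'a \<Rightarrow> real"
  assumes "finite A" "odd (card A)" "\<And>i. i \<in> A \<Longrightarrow> \<bar>w i\<bar> \<le> 1"
  shows "1 \<le> real (card A) * (\<Sum>i\<in>A. 1 - (w i)\<^sup>2) + (\<Sum>i\<in>A. w i)\<^sup>2"
proof -
  define \<sigma> :: "'a \<Rightarrow> int" where "\<sigma> = (\<lambda>i. if w i < 0 then -1 else 1)"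
  \<comment> \<open>The total distance to the nearest signs.\<close>
  define d where "d = (\<Sum>i\<in>A. 1 - \<bar>w i\<bar>)"
  have d0: "0 \<le> d" using assms(3) by (auto simp: d_def intro!: sum_nonneg)
  have "odd (\<Sum>i\<in>A. \<sigma> i) \<longleftrightarrow> odd (card A)"
    using assms(1) by (induction A rule: finite_induct) (auto simp: \<sigma>_def)
  then have "(\<Sum>i\<in>A. \<sigma> i) \<noteq> 0" using assms(2) by (metis even_zero)
  then have "1 \<le> \<bar>\<Sum>i\<in>A. \<sigma> i\<bar>" by linarith
  then have s: "1 \<le> \<bar>\<Sum>i\<in>A. real_of_int (\<sigma> i)\<bar>" by (simp flip: of_int_sum of_int_abs)
  have "\<bar>(\<Sum>i\<in>A. real_of_int (\<sigma> i)) - (\<Sum>i\<in>A. w i)\<bar> \<le> (\<Sum>i\<in>A. \<bar>real_of_int (\<sigma> i) - w i\<bar>)"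
    unfolding sum_subtractf[symmetric] by (rule sum_abs)
  also have "\<dots> = d"
    unfolding d_def using assms(3) by (intro sum.cong) (force simp: \<sigma>_def abs_if)+
  finally have w: "1 - d \<le> \<bar>\<Sum>i\<in>A. w i\<bar>" using s by linarith
  have "d \<le> (\<Sum>i\<in>A. 1 - (w i)\<^sup>2)"
    unfolding d_def
  proof (rule sum_mono)
    fix i assume "i \<in> A"
    then have "\<bar>w i\<bar> * \<bar>w i\<bar> \<le> \<bar>w i\<bar> * 1" using assms(3) by (intro mult_left_mono) auto
    then show "1 - \<bar>w i\<bar> \<le> 1 - (w i)\<^sup>2" by (simp add: power2_eq_square)
  qed
  then have D: "real (card A) * d \<le> real (card A) * (\<Sum>i\<in>A. 1 - (w i)\<^sup>2)"
    by (intro mult_left_mono) auto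
  have c1: "1 \<le> card A" using assms(2) by (cases "card A") auto
  show ?thesis
  proof (cases "d < 1")
    case False
    have "1 * 1 \<le> real (card A) * d" using c1 False by (intro mult_mono) auto
    with D show ?thesis by (smt (verit) zero_le_power2)
  next
    case True
    from w True have w2: "(1 - d)\<^sup>2 \<le> (\<Sum>i\<in>A. w i)\<^sup>2"
      by (metis abs_ge_zero diff_ge_0_iff_ge less_eq_real_def power2_abs power_mono)
    show ?thesis
    proof (cases "card A = 1")
      case True
      then obtain i where A: "A = {i}" by (auto simp: card_1_singleton_iff)
      then show ?thesis by simp
    next
      case False
      \<comment> \<open>With at least two summands, the penalty outweighs the term \<open>- 2 d\<close> of \<open>(1 - d)\<^sup>2\<close>.\<close>
      with c1 have "2 * d \<le> real (card A) * d" using d0 by (intro mult_right_mono) auto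
      then have "1 \<le> real (card A) * d + (1 - d)\<^sup>2"
        by (simp add: power2_eq_square algebra_simps) (smt (verit) zero_le_square)
      with D w2 show ?thesis by linarith
    qed
  qed
qed

text \<open>
  Popoviciu's inequality in its sharp form for finite samples: the bound is attained if
  \<open>\<lfloor>n / 2\<rfloor>\<close> of the \<open>n\<close> numbers are \<open>p\<close> and the others are \<open>q\<close>.
\<close>

lemma sample_variance_bound:
  fixes x :: "'a \<Rightarrow> real"
  assumes "finite A" "\<And>i. i \<in> A \<Longrightarrow> x i \<in> {p..q}"
  shows "real (card A) * (\<Sum>i\<in>A. (x i)\<^sup>2) - (\<Sum>i\<in>A. x i)\<^sup>2 \<le> real ((card A)\<^sup>2 div 4) * (q - p)\<^sup>2"
proof (cases "p < q")
  case False
  then have "x i = p" if "i \<in> A" for i using assms(2)[OF that] by auto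
  then have "(\<Sum>i\<in>A. (x i)\<^sup>2) = (\<Sum>i\<in>A. p\<^sup>2)" "(\<Sum>i\<in>A. x i) = (\<Sum>i\<in>A. p)"
    by (auto intro!: sum.cong)
  then show ?thesis by (simp add: power2_eq_square)
next
  case True
  define n where "n = card A"
  define L where "L = q - p"
  \<comment> \<open>The sample rescaled from \<open>[p, q]\<close> to \<open>[-1, 1]\<close>.\<close>
  define w where "w = (\<lambda>i. (2 * x i - (p + q)) / L)"
  define W where "W = (\<Sum>i\<in>A. w i)"
  define W2 where "W2 = (\<Sum>i\<in>A. (w i)\<^sup>2)"
  have L: "0 < L" using True by (simp add: L_def)
  have w1: "\<bar>w i\<bar> \<le> 1" if "i \<in> A" for i
    using assms(2)[OF that] L by (auto simp: w_def L_def abs_le_iff field_simps)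
  have x: "x i = (p + q) / 2 + L / 2 * w i" for i
    using L by (simp add: w_def field_simps)
  have S1: "(\<Sum>i\<in>A. x i) = real n * ((p + q) / 2) + L / 2 * W"
    by (simp only: x sum.distrib sum_constant sum_distrib_left n_def W_def)
  have "(x i)\<^sup>2 = ((p + q) / 2)\<^sup>2 + (p + q) * L / 2 * w i + L\<^sup>2 / 4 * (w i)\<^sup>2" for i
    by (simp only: x) (simp add: power2_eq_square field_simps)
  then have S2: "(\<Sum>i\<in>A. (x i)\<^sup>2)
      = real n * ((p + q) / 2)\<^sup>2 + (p + q) * L / 2 * W + L\<^sup>2 / 4 * W2"
    by (simp only: sum.distrib sum_constant sum_distrib_left n_def W_def W2_def)
  have eq: "real n * (\<Sum>i\<in>A. (x i)\<^sup>2) - (\<Sum>i\<in>A. x i)\<^sup>2 = L\<^sup>2 / 4 * (real n * W2 - W\<^sup>2)"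
    unfolding S1 S2 by (simp add: power2_eq_square field_simps)
  have "real n * W2 - W\<^sup>2 \<le> 4 * real (n\<^sup>2 div 4)"
  proof (cases "even n")
    case True
    then obtain k where k: "n = 2 * k" by blast
    have "W2 \<le> (\<Sum>i\<in>A. 1)"
      unfolding W2_def using w1 by (intro sum_mono) (auto simp: abs_square_le_1)
    then have "real n * W2 \<le> real n * real n" by (intro mult_left_mono) (auto simp: n_def)
    also have "\<dots> = 4 * real (n\<^sup>2 div 4)" by (simp add: k power2_eq_square)
    finally show ?thesis by (smt (verit) zero_le_power2)
  next
    case False
    then obtain k where k: "n = 2 * k + 1" by (blast elim: oddE)
    have "1 \<le> real n * (real n - W2) + W\<^sup>2"
      using odd_card_sum_squares[OF assms(1), of w] False w1
      by (simp add: n_def W_def W2_def sum_subtractf)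
    then have "real n * W2 - W\<^sup>2 \<le> real n * real n - 1" by (simp add: algebra_simps)
    also have "n\<^sup>2 = 1 + (k\<^sup>2 + k) * 4" by (simp add: k power2_eq_square algebra_simps)
    then have "n\<^sup>2 div 4 = k\<^sup>2 + k" by simp
    then have "real n * real n - 1 = 4 * real (n\<^sup>2 div 4)"
      by (simp add: k power2_eq_square algebra_simps)
    finally show ?thesis .
  qed
  then have "L\<^sup>2 / 4 * (real n * W2 - W\<^sup>2) \<le> L\<^sup>2 / 4 * (4 * real (n\<^sup>2 div 4))"
    by (intro mult_left_mono) auto
  then show ?thesis using eq by (simp add: n_def L_def mult.commute)
qed

section \<open>Knot averages\<close>

lemma sum_ordered_pairs:
  fixes x :: "nat \<Rightarrow> real"
  shows "2 * (\<Sum>(r, s) \<in> {(r, s). 1 \<le> r \<and> r < s \<and> s \<le> m}. x r * x s)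
    = (\<Sum>r=1..m. x r)\<^sup>2 - (\<Sum>r=1..m. (x r)\<^sup>2)"
proof (induction m)
  case 0
  have "{(r, s). 1 \<le> r \<and> r < s \<and> s \<le> (0::nat)} = {}" by auto
  then show ?case by (simp only: sum.empty) simp
next
  case (Suc m)
  let ?P = "\<lambda>m. {(r, s). 1 \<le> r \<and> r < s \<and> s \<le> (m::nat)}"
  let ?Q = "(\<lambda>r. (r, Suc m)) ` {1..m}"
  have fin: "finite (?P m)" by (rule finite_subset[of _ "{1..m} \<times> {1..m}"]) auto
  have "?P (Suc m) = ?P m \<union> ?Q" by (auto simp: le_Suc_eq)
  moreover have "?P m \<inter> ?Q = {}" by auto
  ultimately have "(\<Sum>(r, s) \<in> ?P (Suc m). x r * x s)
      = (\<Sum>(r, s) \<in> ?P m. x r * x s) + (\<Sum>(r, s) \<in> ?Q. x r * x s)"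
    using fin by (simp add: sum.union_disjoint del: One_nat_def)
  also have "(\<Sum>(r, s) \<in> ?Q. x r * x s) = (\<Sum>r=1..m. x r) * x (Suc m)"
    by (subst sum.reindex) (auto simp: inj_on_def sum_distrib_right)
  finally show ?case using Suc.IH by (simp add: power2_eq_square algebra_simps)
qed

lemma knot_var_eq:
  assumes "2 \<le> m"
  shows "knot_var m t j = (real m * (\<Sum>r=1..m. (t (j + 1 - int r))\<^sup>2)
    - (\<Sum>r=1..m. t (j + 1 - int r))\<^sup>2) / ((real m)\<^sup>2 * (real m - 1))"
proof -
  define S where "S = (\<Sum>r=1..m. t (j + 1 - int r))"
  define P where "P = (\<Sum>r=1..m. (t (j + 1 - int r))\<^sup>2)"
  have "knot_avg2 m t j = 1 / (real m * (real m - 1)) * (S\<^sup>2 - P)"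
    using sum_ordered_pairs[where x = "\<lambda>r. t (j + 1 - int r)" and m = m]
    by (simp add: knot_avg2_def S_def P_def)
  moreover have "knot_avg m t j = S / real m" by (simp add: knot_avg_def S_def)
  moreover have "(S / M)\<^sup>2 - 1 / (M * (M - 1)) * (S\<^sup>2 - P) = (M * P - S\<^sup>2) / (M\<^sup>2 * (M - 1))"
    if "1 < M" for M
    using that by (simp add: divide_simps) (simp add: power2_eq_square algebra_simps)
  from this[of "real m"] have "(S / real m)\<^sup>2 - 1 / (real m * (real m - 1)) * (S\<^sup>2 - P)
      = (real m * P - S\<^sup>2) / ((real m)\<^sup>2 * (real m - 1))"
    using assms by simp
  ultimately show ?thesis by (simp only: knot_var_def S_def[symmetric] P_def[symmetric])
qed

lemma knot_avg_diff:
  assumes "1 \<le> m"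
  shows "knot_avg m t (j + 1) - knot_avg m t j = (t (j + 1) - t (j + 1 - int m)) / real m"
proof -
  have "(\<Sum>r=1..m. t (j + 1 + 1 - int r)) - (\<Sum>r=1..m. t (j + 1 - int r)) = t (j + 1) - t (j + 1 - int m)"
    by (induction m) (auto simp: algebra_simps)
  then show ?thesis by (simp add: knot_avg_def diff_divide_distrib[symmetric])
qed

lemma knot_avg_mem:
  assumes "1 \<le> m" "\<And>r. 1 \<le> r \<Longrightarrow> r \<le> m \<Longrightarrow> t (j + 1 - int r) \<in> {p..q}"
  shows "knot_avg m t j \<in> {p..q}"
proof -
  have "(\<Sum>r=1..m. p) \<le> (\<Sum>r=1..m. t (j + 1 - int r))" "(\<Sum>r=1..m. t (j + 1 - int r)) \<le> (\<Sum>r=1..m. q)"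
    using assms(2) by (intro sum_mono; force)+
  then show ?thesis using assms(1) by (simp add: knot_avg_def field_simps)
qed

section \<open>Norm of the coefficient functionals\<close>

lemma divdiff2_functional_bound:
  assumes "x < y" "y < z" "0 \<le> v" "\<bar>f x\<bar> \<le> 1" "\<bar>f y\<bar> \<le> 1" "\<bar>f z\<bar> \<le> 1"
  shows "\<bar>f y - v * divdiff2 x y z f\<bar> \<le> 1 + 2 * (v / ((z - y) * (y - x)))"
proof -
  \<comment> \<open>The negatives of the coefficients of \<open>f z\<close> and \<open>f x\<close> in the functional; that of \<open>f y\<close>
      is \<open>1 + A + B\<close>.\<close>
  define A where "A = v / ((z - y) * (z - x))"
  define B where "B = v / ((y - x) * (z - x))"
  have pos: "0 < z - y" "0 < y - x" "0 < z - x" using assms by auto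
  have AB: "0 \<le> A" "0 \<le> B" using pos assms(3) by (auto simp: A_def B_def)
  have "A = v * (y - x) / ((z - y) * (y - x) * (z - x))" using pos by (simp add: A_def)
  moreover have "B = v * (z - y) / ((z - y) * (y - x) * (z - x))" using pos by (simp add: B_def)
  ultimately have "A + B = v * ((y - x) + (z - y)) / ((z - y) * (y - x) * (z - x))"
    by (simp only: distrib_left add_divide_distrib)
  also have "(y - x) + (z - y) = z - x" by simp
  also have "v * (z - x) / ((z - y) * (y - x) * (z - x)) = v / ((z - y) * (y - x))"
    using pos by (intro nonzero_mult_divide_mult_cancel_right) auto
  finally have sum: "A + B = v / ((z - y) * (y - x))" .
  have "v * divdiff2 x y z f = A * (f z - f y) - B * (f y - f x)"
    by (simp add: divdiff2_def A_def B_def diff_divide_distrib right_diff_distrib)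
  then have "\<bar>f y - v * divdiff2 x y z f\<bar> = \<bar>(1 + (A + B)) * f y - A * f z - B * f x\<bar>"
    by (simp add: algebra_simps)
  also have "\<dots> \<le> \<bar>(1 + (A + B)) * f y\<bar> + \<bar>A * f z\<bar> + \<bar>B * f x\<bar>" by linarith
  also have "\<dots> \<le> (1 + (A + B)) * 1 + A * 1 + B * 1"
    using AB assms(4-6) by (intro add_mono) (auto simp: abs_mult intro!: mult_left_le)
  finally show ?thesis using sum by simp
qed

text \<open>
  For odd \<open>m\<close> both sides are equal to \<open>(m + 3) / 2\<close>; here the floor in \<open>\<lfloor>m\<^sup>2 / 4\<rfloor>\<close>, that is, the
  sharp form of the variance bound, is needed.
\<close>

lemma norm_constant_le:
  assumes "2 \<le> (m::nat)"
  shows "1 + 2 * (real (m\<^sup>2 div 4) / (real m - 1)) \<le> of_int \<lfloor>(real m + 4) / 2\<rfloor>"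
proof (cases "even m")
  case True
  then obtain k where k: "m = 2 * k" by blast
  have "\<lfloor>(real m + 4) / 2\<rfloor> = int k + 2" by (simp add: k floor_eq_iff)
  moreover have "m\<^sup>2 div 4 = k\<^sup>2" by (simp add: k power2_eq_square)
  ultimately show ?thesis
    using assms by (simp add: k field_simps power2_eq_square)
next
  case False
  then obtain k where k: "m = 2 * k + 1" by (blast elim: oddE)
  have "\<lfloor>(real m + 4) / 2\<rfloor> = int k + 2" by (simp add: k floor_eq_iff)
  moreover have "m\<^sup>2 = 1 + (k\<^sup>2 + k) * 4" by (simp add: k power2_eq_square algebra_simps)
  then have "m\<^sup>2 div 4 = k\<^sup>2 + k" by simp
  ultimately show ?thesis
    using assms by (simp add: k field_simps power2_eq_square)
qed

text \<open>
  Strict monotonicity of the knots is not needed: if the denominators in the divided difference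
  are not all positive, then the knots averaged in \<open>\<theta>\<^sub>j\<close> coincide and \<open>knot_var m t j = 0\<close>.
\<close>

lemma abs_qi_functional_le:
  assumes m: "2 \<le> m" and mono: "mono_on {j - int m..j + 1} t"
    and f: "\<And>x. x \<in> {t (j - int m)..t (j + 1)} \<Longrightarrow> \<bar>f x\<bar> \<le> 1"
  shows "\<bar>qi_functional m t j f\<bar> \<le> of_int \<lfloor>(real m + 4) / 2\<rfloor>"
proof -
  have mo: "t u \<le> t v" if "j - int m \<le> u" "u \<le> v" "v \<le> j + 1" for u v
    using mono that by (auto simp: mono_on_def)
  let ?x = "knot_avg m t (j - 1)" and ?y = "knot_avg m t j" and ?z = "knot_avg m t (j + 1)"
  let ?v = "knot_var m t j"
  define L where "L = t j - t (j + 1 - int m)"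
  have "knot_avg m t i \<in> {t (j - int m)..t (j + 1)}" if "i \<in> {j - 1, j, j + 1}" for i
  proof (rule knot_avg_mem)
    fix r assume "1 \<le> r" "r \<le> m"
    then have "j - int m \<le> i + 1 - int r" "i + 1 - int r \<le> j + 1" using that by auto
    then show "t (i + 1 - int r) \<in> {t (j - int m)..t (j + 1)}"
      unfolding atLeastAtMost_iff by (intro conjI mo) auto
  qed (use m in simp)
  then have fb: "\<bar>f ?x\<bar> \<le> 1" "\<bar>f ?y\<bar> \<le> 1" "\<bar>f ?z\<bar> \<le> 1" by (auto intro!: f simp del: atLeastAtMost_iff)
  have "0 \<le> real (m\<^sup>2 div 4) / (real m - 1)" using m by simp
  then have K: "1 \<le> real_of_int \<lfloor>(real m + 4) / 2\<rfloor>" using norm_constant_le[OF m] by linarith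
  show ?thesis
  proof (cases "L = 0")
    case True
    then have "t (j + 1 - int r) = t j" if "1 \<le> r" "r \<le> m" for r
      using mo[of "j + 1 - int m" "j + 1 - int r"] mo[of "j + 1 - int r" j] that m
      by (simp add: L_def)
    then have "?v = 0" by (rule knot_var_eq_0[OF m])
    then have "\<bar>qi_functional m t j f\<bar> \<le> 1" using fb by (simp add: qi_functional_def)
    with K show ?thesis by linarith
  next
    case False
    then have L: "0 < L" using mo[of "j + 1 - int m" j] m by (simp add: L_def)
    have h: "L / real m \<le> ?z - ?y"
      using knot_avg_diff[of m t j] mo[of j "j + 1"] m by (simp add: L_def divide_right_mono)
    have h': "L / real m \<le> ?y - ?x"
      using knot_avg_diff[of m t "j - 1"] mo[of "j - int m" "j + 1 - int m"] m
      by (simp add: L_def divide_right_mono)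
    have Lm: "0 < L / real m" using L m by simp
    define V where "V = real m * (\<Sum>r=1..m. (t (j + 1 - int r))\<^sup>2) - (\<Sum>r=1..m. t (j + 1 - int r))\<^sup>2"
    have v: "?v = V / ((real m)\<^sup>2 * (real m - 1))"
      using knot_var_eq[OF m] by (simp add: V_def)
    have V_le: "V \<le> real (m\<^sup>2 div 4) * L\<^sup>2"
    proof -
      have "t (j + 1 - int r) \<in> {t (j + 1 - int m)..t j}" if "r \<in> {1..m}" for r
        unfolding atLeastAtMost_iff using that by (intro conjI mo) auto
      from sample_variance_bound[of "{1..m}", OF _ this] show ?thesis by (simp add: V_def L_def)
    qed
    have V_ge: "0 \<le> V"
      using Cauchy_Schwarz_ineq_sum[of "\<lambda>_. 1" "\<lambda>r. t (j + 1 - int r)" "{1..m}"]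
      by (simp add: V_def)
    have v_ge: "0 \<le> ?v" using V_ge m by (simp add: v)
    have "(L / real m) * (L / real m) \<le> (?z - ?y) * (?y - ?x)"
      using h h' Lm by (intro mult_mono) auto
    then have "?v / ((?z - ?y) * (?y - ?x)) \<le> ?v / ((L / real m) * (L / real m))"
      using v_ge Lm by (intro frac_le mult_pos_pos) auto
    also have "\<dots> = V / L\<^sup>2 / (real m - 1)"
      using L m by (simp add: v field_simps power2_eq_square)
    also have "\<dots> \<le> real (m\<^sup>2 div 4) / (real m - 1)"
      using V_le L m by (intro divide_right_mono) (auto simp: divide_le_eq)
    finally have ratio: "?v / ((?z - ?y) * (?y - ?x)) \<le> real (m\<^sup>2 div 4) / (real m - 1)" .
    have "\<bar>qi_functional m t j f\<bar> \<le> 1 + 2 * (?v / ((?z - ?y) * (?y - ?x)))"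
      unfolding qi_functional_def using h h' Lm v_ge fb
      by (intro divdiff2_functional_bound) auto
    with ratio norm_constant_le[OF m] show ?thesis by linarith
  qed
qed

section \<open>Norm of the quasi-interpolant\<close>

lemma bspline_nonneg:
  assumes "mono_on {j - int k..j + 1} t"
  shows "0 \<le> bspline I t k j x"
  using assms
proof (induction k arbitrary: j)
  case (Suc k)
  have m: "t u \<le> t v" if "j - int k - 1 \<le> u" "u \<le> v" "v \<le> j + 1" for u v
    using that Suc.prems by (auto simp: mono_on_def)
  have m1: "mono_on {j - int k..j + 1} t" and m2: "mono_on {j - 1 - int k..j - 1 + 1} t"
    using m by (auto simp: mono_on_def)
  have "0 \<le> (x - t (j - int k - 1)) / (t j - t (j - int k - 1)) * bspline I t k (j - 1) x"
  proof (cases "bspline I t k (j - 1) x = 0")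
    case False
    from bspline_nonzeroD[OF this m2] Suc.IH[OF m2] show ?thesis
      by (intro mult_nonneg_nonneg divide_nonneg_nonneg) (auto simp: algebra_simps)
  qed simp
  moreover have "0 \<le> (t (j + 1) - x) / (t (j + 1) - t (j - int k)) * bspline I t k j x"
  proof (cases "bspline I t k j x = 0")
    case False
    from bspline_nonzeroD[OF this m1] Suc.IH[OF m1] show ?thesis
      by (intro mult_nonneg_nonneg divide_nonneg_nonneg) auto
  qed simp
  ultimately show ?case by simp
qed simp

lemma spline_partition_support:
  assumes "spline_partition m I J t" "j \<in> J"
  shows "mono_on {j - int m..j + 1} t" "{t (j - int m)..t (j + 1)} \<subseteq> I"
proof -
  have "mono_on {j - int m..j + 1} t \<and> {t (j - int m)..t (j + 1)} \<subseteq> I"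
    using assms
  proof cases
    case line
    then show ?thesis
      by (auto simp: line_knots_def strict_mono_less_eq intro!: mono_onI)
  next
    case (interval a b n)
    note mo = interval_knots_mono[OF interval(3-5)]
    have "{j - int m..j + 1} \<subseteq> {- int m..int n + int m}" using assms(2) interval by auto
    then show ?thesis
      using mono_on_subset[OF mo(1)] mo(2)[of "j - int m"] mo(2)[of "j + 1"] assms(2) interval
      by auto
  qed
  then show "mono_on {j - int m..j + 1} t" "{t (j - int m)..t (j + 1)} \<subseteq> I" by auto
qed

lemma abs_quasi_interpolant_le:
  assumes "2 \<le> m" "spline_partition m I J t" "\<And>y. y \<in> I \<Longrightarrow> \<bar>f y\<bar> \<le> 1" "x \<in> I"
  shows "\<bar>quasi_interpolant m I J t f x\<bar> \<le> of_int \<lfloor>(real m + 4) / 2\<rfloor>"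
proof -
  let ?K = "real_of_int \<lfloor>(real m + 4) / 2\<rfloor>"
  let ?B = "\<lambda>j. bspline I t m j x"
  have one: "(\<Sum>\<^sub>\<infinity>j\<in>J. ?B j) = 1" by (rule bspline_sum_eq_1[OF assms(2,4)])
  \<comment> \<open>Infinite sums that do not converge are zero by convention.\<close>
  then have summ: "?B summable_on J" using infsum_not_exists by fastforce
  have le: "norm (qi_functional m t j f * ?B j) \<le> ?K * ?B j" if "j \<in> J" for j
  proof -
    note s = spline_partition_support[OF assms(2) that]
    have "\<bar>qi_functional m t j f\<bar> \<le> ?K"
      using s(2) assms(3) by (intro abs_qi_functional_le[OF assms(1) s(1)]) auto
    then show ?thesis
      using bspline_nonneg[OF s(1)] by (auto simp: abs_mult intro!: mult_right_mono)
  qed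
  have summK: "(\<lambda>j. ?K * ?B j) summable_on J" using summ by (rule summable_on_cmult_right)
  have abs: "(\<lambda>j. norm (qi_functional m t j f * ?B j)) summable_on J"
    by (rule summable_on_comparison_test[OF summK]) (use le in auto)
  have "norm (\<Sum>\<^sub>\<infinity>j\<in>J. qi_functional m t j f * ?B j) \<le> (\<Sum>\<^sub>\<infinity>j\<in>J. norm (qi_functional m t j f * ?B j))"
    using abs by (rule norm_infsum_bound)
  also have "\<dots> \<le> (\<Sum>\<^sub>\<infinity>j\<in>J. ?K * ?B j)"
    using abs summK le by (rule infsum_mono)
  also have "\<dots> = ?K" using one by (simp add: infsum_cmult_right')
  finally show ?thesis by (simp add: quasi_interpolant_def)
qed

theorem theorem1:
  fixes m :: nat and I :: "real set" and J :: "int set" and t :: "int \<Rightarrow> real"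
  assumes "2 \<le> m" and "spline_partition m I J t"
  shows "op_norm_on I (quasi_interpolant m I J t) \<le> ereal (of_int \<lfloor>(real m + 4) / 2\<rfloor>)"
  unfolding op_norm_on_def
proof (rule SUP_least)
  fix f assume "f \<in> {f. continuous_on I f \<and> bounded (f ` I) \<and> sup_norm_on I f \<le> 1}"
  then have "\<bar>f y\<bar> \<le> 1" if "y \<in> I" for y
    using that by (auto simp: sup_norm_on_def SUP_le_iff)
  then show "sup_norm_on I (quasi_interpolant m I J t f) \<le> ereal (of_int \<lfloor>(real m + 4) / 2\<rfloor>)"
    unfolding sup_norm_on_def
    by (intro SUP_least) (simp only: ereal_less_eq, rule abs_quasi_interpolant_le[OF assms])
qed

end
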